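(* There is a single sentence $\varphi$ of first-order logic in the language of graphs such that for all $k \geq 1$ \[ \lim_{n \to \infty} \frac{\left|\{\mathcal{G} \in \mathbb{G}_k(n) : \mathcal{G} \models \varphi\}\right|}{\left|\mathbb{G}_k(n)\right|} \notin \{0, 1\}. \]
   Context: Notation: $\omega=\{0,1,2,\dots\}$ and $[m]=\{0,1,\dots,m-1\}$; $\mathcal{P}(Z)$ is the power set of $Z$; $k$ and $n$ range over $\omega$. Graphs are simple undirected graphs. The language of graphs has a single binary relation symbol $E$ for adjacency (and equality). For $k,n\in\omega$, a $k$-rainbow sequence on $[n]$ is a pair $S=(a,e)$ of functions $a:[n]\to[k]$ and $e:[n]\to\mathcal{P}([k])$. The graph associated with $S$ is the graph on vertex set $[n]$ in which, for all $x<y$ in $[n]$, $x$ and $y$ are adjacent if and only if $a(x)\in e(y)$. $\mathbb{G}_k(n)$ denotes the set of all (labelled) graphs on vertex set $[n]$ that are associated with some $k$-rainbow sequence on $[n]$ (the $k$-rainbow threshold graphs on $[n]$). *)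

theory Defs
  imports Complex_Main "HOL-Library.FuncSet"
begin

text \<open>A graph is a pair of a vertex set and a set of edges, the edges being
  two-element sets of vertices.\<close>

type_synonym 'v graph = "'v set \<times> 'v set set"

abbreviation verts :: "'v graph \<Rightarrow> 'v set" where
  "verts \<equiv> fst"

abbreviation edges :: "'v graph \<Rightarrow> 'v set set" where
  "edges \<equiv> snd"

definition simple_graph :: "'v graph \<Rightarrow> bool" where
  "simple_graph G \<longleftrightarrow> (\<forall>A \<in> edges G. A \<subseteq> verts G \<and> card A = 2)"

definition adjacent :: "'v graph \<Rightarrow> 'v \<Rightarrow> 'v \<Rightarrow> bool" where
  "adjacent G x y \<longleftrightarrow> {x, y} \<in> edges G"

text \<open>Formulas over the single binary relation symbol E and equality; variables are
  named by natural numbers.\<close>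

datatype formula =
    Eq nat nat
  | E nat nat
  | Neg formula
  | Conj formula formula
  | Disj formula formula
  | Impl formula formula
  | Exists nat formula
  | Forall nat formula

primrec free_vars :: "formula \<Rightarrow> nat set" where
  "free_vars (Eq i j) = {i, j}"
| "free_vars (E i j) = {i, j}"
| "free_vars (Neg p) = free_vars p"
| "free_vars (Conj p q) = free_vars p \<union> free_vars q"
| "free_vars (Disj p q) = free_vars p \<union> free_vars q"
| "free_vars (Impl p q) = free_vars p \<union> free_vars q"
| "free_vars (Exists i p) = free_vars p - {i}"
| "free_vars (Forall i p) = free_vars p - {i}"

definition sentence :: "formula \<Rightarrow> bool" where
  "sentence p \<longleftrightarrow> free_vars p = {}"

primrec sat :: "'v graph \<Rightarrow> (nat \<Rightarrow> 'v) \<Rightarrow> formula \<Rightarrow> bool" where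
  "sat G s (Eq i j) \<longleftrightarrow> s i = s j"
| "sat G s (E i j) \<longleftrightarrow> adjacent G (s i) (s j)"
| "sat G s (Neg p) \<longleftrightarrow> \<not> sat G s p"
| "sat G s (Conj p q) \<longleftrightarrow> sat G s p \<and> sat G s q"
| "sat G s (Disj p q) \<longleftrightarrow> sat G s p \<or> sat G s q"
| "sat G s (Impl p q) \<longleftrightarrow> (sat G s p \<longrightarrow> sat G s q)"
| "sat G s (Exists i p) \<longleftrightarrow> (\<exists>v \<in> verts G. sat G (s(i := v)) p)"
| "sat G s (Forall i p) \<longleftrightarrow> (\<forall>v \<in> verts G. sat G (s(i := v)) p)"

text \<open>For a sentence the choice of assignment is immaterial (see \<open>models_iff_sat\<close> below).
  Assignments are not required to take values in the vertex set, so that the definition is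
  also correct for the graph without vertices.\<close>

definition models :: "'v graph \<Rightarrow> formula \<Rightarrow> bool"  (infix "\<Turnstile>" 50) where
  "G \<Turnstile> p \<longleftrightarrow> (\<forall>s. sat G s p)"

lemma sat_cong:
  "(\<And>i. i \<in> free_vars p \<Longrightarrow> s i = t i) \<Longrightarrow> sat G s p \<longleftrightarrow> sat G t p"
proof (induction p arbitrary: s t)
  case (Exists i p)
  have "sat G (s(i := v)) p \<longleftrightarrow> sat G (t(i := v)) p" for v
    by (rule Exists.IH) (use Exists.prems in auto)
  then show ?case by simp
next
  case (Forall i p)
  have "sat G (s(i := v)) p \<longleftrightarrow> sat G (t(i := v)) p" for v
    by (rule Forall.IH) (use Forall.prems in auto)
  then show ?case by simp
next
  case (Neg p)
  have "sat G s p \<longleftrightarrow> sat G t p" by (rule Neg.IH) (use Neg.prems in simp)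
  then show ?case by simp
next
  case (Conj p q)
  have "sat G s p \<longleftrightarrow> sat G t p" by (rule Conj.IH(1)) (use Conj.prems in simp)
  moreover have "sat G s q \<longleftrightarrow> sat G t q" by (rule Conj.IH(2)) (use Conj.prems in simp)
  ultimately show ?case by simp
next
  case (Disj p q)
  have "sat G s p \<longleftrightarrow> sat G t p" by (rule Disj.IH(1)) (use Disj.prems in simp)
  moreover have "sat G s q \<longleftrightarrow> sat G t q" by (rule Disj.IH(2)) (use Disj.prems in simp)
  ultimately show ?case by simp
next
  case (Impl p q)
  have "sat G s p \<longleftrightarrow> sat G t p" by (rule Impl.IH(1)) (use Impl.prems in simp)
  moreover have "sat G s q \<longleftrightarrow> sat G t q" by (rule Impl.IH(2)) (use Impl.prems in simp)
  ultimately show ?case by simp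
qed simp_all

lemma models_iff_sat: "sentence p \<Longrightarrow> G \<Turnstile> p \<longleftrightarrow> sat G s p"
  using sat_cong[of p _ s G] by (auto simp: models_def sentence_def)

text \<open>The set \<open>[m]\<close> is \<open>{..<m}\<close>. Functions with domain \<open>[n]\<close> are rendered by
  extensional functions.\<close>

definition rainbow_sequences :: "nat \<Rightarrow> nat \<Rightarrow> ((nat \<Rightarrow> nat) \<times> (nat \<Rightarrow> nat set)) set" where
  "rainbow_sequences k n =
     ({..<n} \<rightarrow>\<^sub>E {..<k}) \<times> ({..<n} \<rightarrow>\<^sub>E Pow {..<k})"

definition graph_of :: "nat \<Rightarrow> (nat \<Rightarrow> nat) \<times> (nat \<Rightarrow> nat set) \<Rightarrow> nat graph" where
  "graph_of n = (\<lambda>(a, e). ({..<n}, {{x, y} | x y. x < y \<and> y < n \<and> a x \<in> e y}))"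

definition rainbow_threshold_graphs :: "nat \<Rightarrow> nat \<Rightarrow> nat graph set"  ("\<bbbG>") where
  "\<bbbG> k n = graph_of n ` rainbow_sequences k n"

lemma simple_graph_graph_of: "simple_graph (graph_of n S)"
  by (auto simp: simple_graph_def graph_of_def card_2_iff split: prod.splits)

lemma adjacent_graph_of:
  "x < y \<Longrightarrow> y < n \<Longrightarrow> adjacent (graph_of n (a, e)) x y \<longleftrightarrow> a x \<in> e y"
  by (auto simp: adjacent_def graph_of_def doubleton_eq_iff)

lemma finite_rainbow_threshold_graphs: "finite (\<bbbG> k n)"
  unfolding rainbow_threshold_graphs_def rainbow_sequences_def
  by (intro finite_imageI finite_cartesian_product finite_PiE) auto

lemma rainbow_threshold_graphs_nonempty: "k \<ge> 1 \<Longrightarrow> \<bbbG> k n \<noteq> {}"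
  unfolding rainbow_threshold_graphs_def rainbow_sequences_def
  by (auto simp: PiE_eq_empty_iff lessThan_def dest: spec[of _ 0])

end

theory Submission
  imports Defs
begin

text \<open>The sentence says that there is an isolated vertex. In a typical sequence every colour
  occurs among the first \<open>m\<close> vertices and every singleton \<open>{c}\<close> occurs as \<open>e y\<close> among the
  last \<open>m\<close>. Up to renaming colours, the graph then determines the letter \<open>(a x, e x)\<close> of every
  vertex in between, and an isolated vertex lies among the last \<open>m\<close>; hence inserting a letter
  after the first \<open>m\<close> multiplies the number of such graphs, with or without isolated vertex, by
  exactly \<open>K = k 2^k\<close>. Since the untypical sequences have small density, the numbers of graphs
  divided by \<open>K^n\<close> form Cauchy sequences. Appending an isolated or a dominating vertex
  at the end separates the two limits from \<open>0\<close> and from each other.\<close>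

section \<open>Adjacency in the graph of a sequence\<close>

lemma graph_of_eq_iff:
  "graph_of n (a, e) = graph_of n (a', e') \<longleftrightarrow>
   (\<forall>x y. x < y \<longrightarrow> y < n \<longrightarrow> (a x \<in> e y \<longleftrightarrow> a' x \<in> e' y))"
proof
  assume "graph_of n (a, e) = graph_of n (a', e')"
  then show "\<forall>x y. x < y \<longrightarrow> y < n \<longrightarrow> (a x \<in> e y \<longleftrightarrow> a' x \<in> e' y)"
    by (metis adjacent_graph_of)
next
  assume "\<forall>x y. x < y \<longrightarrow> y < n \<longrightarrow> (a x \<in> e y \<longleftrightarrow> a' x \<in> e' y)"
  then show "graph_of n (a, e) = graph_of n (a', e')"
    unfolding graph_of_def by auto
qed

lemma graph_of_eqD:
  "graph_of n (a, e) = graph_of n (a', e') \<Longrightarrow> x < y \<Longrightarrow> y < n \<Longrightarrow> a x \<in> e y \<longleftrightarrow> a' x \<in> e' y"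
  by (simp add: graph_of_eq_iff)

lemma adjacent_graph_of_iff:
  "adjacent (graph_of n (a, e)) x y \<longleftrightarrow>
     x < y \<and> y < n \<and> a x \<in> e y \<or> y < x \<and> x < n \<and> a y \<in> e x"
  by (auto simp: adjacent_def graph_of_def doubleton_eq_iff)

lemma verts_graph_of [simp]: "verts (graph_of n S) = {..<n}"
  by (simp add: graph_of_def split: prod.splits)

section \<open>The sentence about isolated vertices\<close>

definition has_isolated :: "'v graph \<Rightarrow> bool" where
  "has_isolated G \<longleftrightarrow> (\<exists>v \<in> verts G. \<forall>w \<in> verts G. \<not> adjacent G v w)"

definition isolated_formula :: formula where
  "isolated_formula = Exists 0 (Forall 1 (Neg (E 0 1)))"

lemma sentence_isolated: "sentence isolated_formula"
  by (auto simp: sentence_def isolated_formula_def)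

lemma models_isolated: "G \<Turnstile> isolated_formula \<longleftrightarrow> has_isolated G"
  by (simp add: models_def isolated_formula_def has_isolated_def)

section \<open>Canonical names for colours\<close>

definition restricted_growth :: "(nat \<Rightarrow> nat) \<Rightarrow> nat \<Rightarrow> bool" where
  "restricted_growth a m \<longleftrightarrow> (\<forall>x<m. a x \<in> a ` {..<x} \<or> a x = card (a ` {..<x}))"

text \<open>The kernel decides whether position \<open>x\<close> repeats a colour or introduces one.
  By strong induction the earlier values agree, so a repeated value agrees, and a new one is in both
  cases the number of colours seen so far.\<close>

lemma restricted_growth_unique:
  assumes "restricted_growth a m" "restricted_growth b m"
    and ker: "\<And>x y. x < m \<Longrightarrow> y < m \<Longrightarrow> a x = a y \<longleftrightarrow> b x = b y"
    and "x < m"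
  shows "a x = b x"
  using \<open>x < m\<close>
proof (induction x rule: less_induct)
  case (less x)
  have img: "a ` {..<x} = b ` {..<x}"
    using less by (intro image_cong) auto
  show ?case
  proof (cases "a x \<in> a ` {..<x}")
    case True
    then obtain y where "y < x" "a x = a y" by auto
    then show ?thesis using less ker[of x y] by auto
  next
    case False
    moreover have "b x \<notin> b ` {..<x}"
      using False less.prems ker by (force simp: image_iff)
    ultimately show ?thesis
      using assms(1,2) less.prems img unfolding restricted_growth_def by metis
  qed
qed

text \<open>Each colour is renamed to the number of colours that first occur before it.\<close>

lemma restricted_growth_exists:
  assumes "a ` {..<m} = {..<k}"
  obtains \<pi> where "bij_betw \<pi> {..<k} {..<k}" "restricted_growth (\<pi> \<circ> a) m"
proof -
  define first where "first c = (LEAST x. a x = c)" for c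
  define \<pi> where "\<pi> c = card (a ` {..<first c})" for c
  have first: "a (first c) = c" "first c < m" if "c < k" for c
  proof -
    obtain x where x: "x < m" "a x = c" using assms \<open>c < k\<close> by (metis imageE lessThan_iff)
    show "a (first c) = c" unfolding first_def using x(2) by (rule LeastI)
    have "first c \<le> x" unfolding first_def using x(2) by (rule Least_le)
    then show "first c < m" using x by simp
  qed
  have new: "c \<notin> a ` {..<first c}" for c
    unfolding first_def by (auto dest: not_less_Least)
  \<comment> \<open>The colour \<open>c\<close> is seen before position \<open>first d\<close> but
    not before \<open>first c\<close>, so the count strictly grows. Injectivity of
    \<open>\<pi>\<close> follows.\<close>
  have less: "\<pi> c < \<pi> d" if "c < k" "d < k" "first c < first d" for c d
    unfolding \<pi>_def
  proof (rule psubset_card_mono)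
    show "a ` {..<first c} \<subset> a ` {..<first d}"
      using new[of c] first(1)[OF \<open>c < k\<close>] \<open>first c < first d\<close> by (force simp: psubset_eq)
  qed simp
  have inj: "inj_on \<pi> {..<k}"
  proof (rule inj_onI)
    fix c d assume cd: "c \<in> {..<k}" "d \<in> {..<k}" "\<pi> c = \<pi> d"
    then have "first c = first d"
      using less[of c d] less[of d c] by (cases "first c" "first d" rule: linorder_cases) auto
    then show "c = d" using cd first(1) by (metis lessThan_iff)
  qed
  have "\<pi> c < k" if "c < k" for c
  proof -
    have "a ` {..<first c} \<subseteq> {..<k}"
      using assms first(2)[OF that] by force
    then have "a ` {..<first c} \<subset> {..<k}" using new[of c] that by blast
    then have "\<pi> c < card {..<k}" unfolding \<pi>_def by (intro psubset_card_mono) auto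
    then show ?thesis by simp
  qed
  then have "\<pi> ` {..<k} = {..<k}" using inj by (intro endo_inj_surj) auto
  then have "bij_betw \<pi> {..<k} {..<k}" using inj by (simp add: bij_betw_def)
  moreover have "restricted_growth (\<pi> \<circ> a) m"
    unfolding restricted_growth_def
  proof (intro allI impI)
    fix x assume "x < m"
    show "(\<pi> \<circ> a) x \<in> (\<pi> \<circ> a) ` {..<x} \<or> (\<pi> \<circ> a) x = card ((\<pi> \<circ> a) ` {..<x})"
    proof (cases "a x \<in> a ` {..<x}")
      case True
      then show ?thesis by auto
    next
      case False
      have "first (a x) = x"
        unfolding first_def
      proof (rule Least_equality)
        fix y assume "a y = a x"
        then show "x \<le> y" using False by (metis image_eqI lessThan_iff not_less)
      qed simp
      moreover have "inj_on \<pi> (a ` {..<x})"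
        using inj by (rule inj_on_subset) (use assms \<open>x < m\<close> in force)
      ultimately have "(\<pi> \<circ> a) x = card ((\<pi> \<circ> a) ` {..<x})"
        by (simp only: \<pi>_def[of "a x"] image_comp[symmetric] card_image comp_apply)
      then show ?thesis ..
    qed
  qed
  ultimately show thesis by (rule that)
qed

section \<open>Well-spread and normal sequences\<close>

text \<open>Early vertices of every colour expose \<open>e y\<close> for later \<open>y\<close>; the
  late singletons tell apart the colours of earlier vertices.\<close>

definition well_spread_sequences ::
  "nat \<Rightarrow> nat \<Rightarrow> nat \<Rightarrow> ((nat \<Rightarrow> nat) \<times> (nat \<Rightarrow> nat set)) set" where
  "well_spread_sequences k m n =
     {(a, e) \<in> rainbow_sequences k n.
        (\<forall>c<k. c \<in> a ` {..<m}) \<and> (\<forall>c<k. {c} \<in> e ` {n - m..<n})}"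

text \<open>Restricted growth removes the freedom to rename colours. Distinct normal sequences can
  still share a graph (\<open>e 0\<close> affects no edge), so graphs are counted below, not
  sequences.\<close>

definition normal_sequences ::
  "nat \<Rightarrow> nat \<Rightarrow> nat \<Rightarrow> ((nat \<Rightarrow> nat) \<times> (nat \<Rightarrow> nat set)) set" where
  "normal_sequences k m n = {(a, e) \<in> well_spread_sequences k m n. restricted_growth a m}"

lemma mem_rainbow_sequences:
  "(a, e) \<in> rainbow_sequences k n \<longleftrightarrow>
     (\<forall>x<n. a x < k) \<and> (\<forall>y<n. e y \<subseteq> {..<k}) \<and> a \<in> extensional {..<n} \<and> e \<in> extensional {..<n}"
  by (auto simp: rainbow_sequences_def PiE_iff)

lemma mem_normal_sequences:
  "(a, e) \<in> normal_sequences k m n \<longleftrightarrow>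
     (a, e) \<in> rainbow_sequences k n \<and> (\<forall>c<k. \<exists>x<m. a x = c) \<and>
     (\<forall>c<k. \<exists>y\<in>{n - m..<n}. e y = {c}) \<and> restricted_growth a m"
proof -
  have "c \<in> a ` {..<m} \<longleftrightarrow> (\<exists>x<m. a x = c)" for c by auto
  moreover have "{c} \<in> e ` {n - m..<n} \<longleftrightarrow> (\<exists>y\<in>{n - m..<n}. e y = {c})" for c
    unfolding image_iff by metis
  ultimately show ?thesis
    by (simp add: normal_sequences_def well_spread_sequences_def)
qed

text \<open>A permutation of the colours, applied to \<open>a\<close> and \<open>e\<close> alike,
  keeps the graph and both spreading conditions. One such permutation brings the start into
  restricted growth.\<close>

lemma graph_of_well_spread_subset_normal:
  assumes "m \<le> n"
  shows "graph_of n ` well_spread_sequences k m n \<subseteq> graph_of n ` normal_sequences k m n"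
proof
  fix G assume "G \<in> graph_of n ` well_spread_sequences k m n"
  then obtain a e where S: "(a, e) \<in> well_spread_sequences k m n" and G: "G = graph_of n (a, e)"
    by auto
  from S have rb: "\<And>x. x < n \<Longrightarrow> a x < k" "\<And>y. y < n \<Longrightarrow> e y \<subseteq> {..<k}"
    by (simp_all add: well_spread_sequences_def mem_rainbow_sequences)
  have "a ` {..<m} = {..<k}"
  proof
    show "a ` {..<m} \<subseteq> {..<k}"
      using rb(1) assms by (simp add: image_subset_iff)
    show "{..<k} \<subseteq> a ` {..<m}"
      using S by (simp add: well_spread_sequences_def subset_iff)
  qed
  then obtain \<pi> where \<pi>: "bij_betw \<pi> {..<k} {..<k}" and rg: "restricted_growth (\<pi> \<circ> a) m"
    by (rule restricted_growth_exists)
  have \<pi>k: "\<pi> ` {..<k} = {..<k}" and inj: "inj_on \<pi> {..<k}"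
    using \<pi> by (auto simp: bij_betw_def)
  \<comment> \<open>\<open>restrict\<close> brings back the value \<open>undefined\<close> outside
    \<open>[n]\<close> that extensional functions must have.\<close>
  define a' where "a' = restrict (\<pi> \<circ> a) {..<n}"
  define e' where "e' = restrict (\<lambda>y. \<pi> ` e y) {..<n}"
  have "restricted_growth a' m"
  proof -
    have "a' x = (\<pi> \<circ> a) x" if "x < m" for x
      using that assms by (simp add: a'_def)
    moreover from this have "a' ` {..<x} = (\<pi> \<circ> a) ` {..<x}" if "x < m" for x
      using that by (intro image_cong) auto
    ultimately show ?thesis
      using rg unfolding restricted_growth_def by (simp del: comp_apply)
  qed
  moreover have "(a', e') \<in> rainbow_sequences k n"
  proof -
    have "\<pi> c < k" if "c < k" for c using \<pi>k that by blast
    moreover have "\<pi> ` e y \<subseteq> {..<k}" if "y < n" for y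
      using image_mono[OF rb(2)[OF that], of \<pi>] \<pi>k by simp
    ultimately show ?thesis
      unfolding mem_rainbow_sequences using rb(1) by (simp add: a'_def e'_def)
  qed
  moreover have "\<forall>c<k. \<exists>x<m. a' x = c"
  proof (intro allI impI)
    fix c assume "c < k"
    then have "c \<in> \<pi> ` {..<k}" using \<pi>k by simp
    then obtain d where "d < k" "\<pi> d = c" by blast
    moreover have "d \<in> a ` {..<m}"
      using S \<open>d < k\<close> by (simp add: well_spread_sequences_def)
    then obtain x where "x < m" "a x = d" by blast
    ultimately show "\<exists>x<m. a' x = c" using assms by (intro exI[of _ x]) (simp add: a'_def)
  qed
  moreover have "\<forall>c<k. \<exists>y\<in>{n - m..<n}. e' y = {c}"
  proof (intro allI impI)
    fix c assume "c < k"
    then have "c \<in> \<pi> ` {..<k}" using \<pi>k by simp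
    then obtain d where "d < k" "\<pi> d = c" by blast
    moreover from \<open>d < k\<close> have "{d} \<in> e ` {n - m..<n}"
      using S by (simp add: well_spread_sequences_def)
    then obtain y where "y \<in> {n - m..<n}" "e y = {d}" by (metis imageE)
    ultimately show "\<exists>y\<in>{n - m..<n}. e' y = {c}"
      by (intro bexI[of _ y]) (auto simp: e'_def)
  qed
  ultimately have "(a', e') \<in> normal_sequences k m n"
    by (simp add: mem_normal_sequences)
  moreover have "graph_of n (a, e) = graph_of n (a', e')"
    unfolding graph_of_eq_iff
  proof (intro allI impI)
    fix x y assume "x < y" "y < n"
    then have "\<pi> (a x) \<in> \<pi> ` e y \<longleftrightarrow> a x \<in> e y"
      by (intro inj_on_image_mem_iff[OF inj]) (simp_all add: rb)
    then show "a x \<in> e y \<longleftrightarrow> a' x \<in> e' y"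
      using \<open>x < y\<close> \<open>y < n\<close> by (simp add: a'_def e'_def)
  qed
  ultimately show "G \<in> graph_of n ` normal_sequences k m n"
    using G by (metis imageI)
qed

text \<open>Outside the two ends, a normal sequence can be read off its graph: before the last
  \<open>m\<close> vertices two vertices have the same colour iff no late vertex separates them, and
  restricted growth fixes the names of the colours.\<close>

lemma normal_sequences_graph_eqD:
  assumes S: "(a, e) \<in> normal_sequences k m n" and T: "(a', e') \<in> normal_sequences k m n"
    and eq: "graph_of n (a, e) = graph_of n (a', e')" and "2 * m \<le> n"
  shows "x < n - m \<Longrightarrow> a x = a' x"
    and "m \<le> y \<Longrightarrow> y < n \<Longrightarrow> e y = e' y"
proof -
  \<comment> \<open>A late \<open>y\<close> with \<open>f' y = {b' x}\<close> is joined to exactly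
    the earlier vertices of colour \<open>b' x\<close>. In the other sequence \<open>x\<close> and
    \<open>z\<close> have equal colours, so \<open>y\<close> treats them alike. The pair is
    arbitrary so that exchanging the sequences gives the converse.\<close>
  have kernel: "b' x = b' z"
    if S: "(b, f) \<in> normal_sequences k m n" and T: "(b', f') \<in> normal_sequences k m n"
      and eq: "graph_of n (b, f) = graph_of n (b', f')"
      and x: "x < n - m" and z: "z < n - m" and bxz: "b x = b z" for b f b' f' x z
  proof -
    have "b' x < k" using T x by (simp add: mem_normal_sequences mem_rainbow_sequences)
    then obtain y where y: "y \<in> {n - m..<n}" "f' y = {b' x}"
      using T unfolding mem_normal_sequences by blast
    have iff: "b w \<in> f y \<longleftrightarrow> b' w \<in> f' y" if "w < n - m" for w
      by (rule graph_of_eqD[OF eq]) (use that y(1) in auto)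
    then have "b' z \<in> f' y" using iff[OF x] iff[OF z] bxz y(2) by simp
    then show ?thesis using y(2) by simp
  qed
  have ker: "a x = a z \<longleftrightarrow> a' x = a' z" if "x < n - m" "z < n - m" for x z
    using kernel[OF S T eq that] kernel[OF T S eq[symmetric] that] by blast
  have start: "a x = a' x" if "x < m" for x
  proof (rule restricted_growth_unique[OF _ _ _ that])
    show "restricted_growth a m" "restricted_growth a' m"
      using S T by (auto simp: mem_normal_sequences)
  qed (use ker \<open>2 * m \<le> n\<close> in auto)
  \<comment> \<open>The colour of \<open>x\<close> already occurs among the first \<open>m\<close>
    vertices, where the names are known to agree.\<close>
  show "a x = a' x" if x: "x < n - m" for x
  proof -
    have "a x < k" using S x by (simp add: mem_normal_sequences mem_rainbow_sequences)
    then obtain z where "z < m" "a z = a x" using S unfolding mem_normal_sequences by blast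
    then show ?thesis using ker[of x z] x start[of z] \<open>2 * m \<le> n\<close> by simp
  qed
  \<comment> \<open>Whether \<open>c\<close> lies in \<open>e y\<close> is seen from the edge
    between \<open>y\<close> and an early vertex of colour \<open>c\<close>.\<close>
  show "e y = e' y" if y: "m \<le> y" "y < n" for y
  proof -
    have "c \<in> e y \<longleftrightarrow> c \<in> e' y" if c: "c < k" for c
    proof -
      obtain z where "z < m" "a z = c" using S c unfolding mem_normal_sequences by blast
      then show ?thesis using graph_of_eqD[OF eq, of z y] y start[of z] by simp
    qed
    moreover have "e y \<subseteq> {..<k}" "e' y \<subseteq> {..<k}"
      using S T y by (auto simp: mem_normal_sequences mem_rainbow_sequences)
    ultimately show ?thesis by blast
  qed
qed

section \<open>Deleting the letter at position \<open>m\<close>\<close>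

text \<open>The increasing enumeration of all natural numbers other than \<open>m\<close>;
  \<open>unskip\<close> inverts it away from \<open>m\<close>.\<close>

definition skip :: "nat \<Rightarrow> nat \<Rightarrow> nat" where
  "skip m i = (if i < m then i else Suc i)"

definition unskip :: "nat \<Rightarrow> nat \<Rightarrow> nat" where
  "unskip m i = (if i < m then i else i - 1)"

lemma unskip_skip [simp]: "unskip m (skip m i) = i"
  by (simp add: skip_def unskip_def)

lemma skip_unskip: "i \<noteq> m \<Longrightarrow> skip m (unskip m i) = i"
  by (auto simp: skip_def unskip_def)

lemma skip_neq [simp]: "skip m i \<noteq> m"
  by (simp add: skip_def)

lemma skip_less_iff [simp]: "skip m i < skip m j \<longleftrightarrow> i < j"
  by (auto simp: skip_def)

lemma skip_less_Suc: "m \<le> n \<Longrightarrow> skip m i < Suc n \<longleftrightarrow> i < n"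
  by (auto simp: skip_def)

abbreviation letters :: "nat \<Rightarrow> (nat \<times> nat set) set" where
  "letters k \<equiv> {..<k} \<times> Pow {..<k}"

definition delete_at ::
  "nat \<Rightarrow> (nat \<Rightarrow> nat) \<times> (nat \<Rightarrow> nat set) \<Rightarrow> (nat \<Rightarrow> nat) \<times> (nat \<Rightarrow> nat set)" where
  "delete_at m = (\<lambda>(a, e). (a \<circ> skip m, e \<circ> skip m))"

definition letter_at :: "nat \<Rightarrow> (nat \<Rightarrow> nat) \<times> (nat \<Rightarrow> nat set) \<Rightarrow> nat \<times> nat set" where
  "letter_at m = (\<lambda>(a, e). (a m, e m))"

lemma restricted_growth_skip [simp]:
  "restricted_growth (a \<circ> skip m) m \<longleftrightarrow> restricted_growth a m"
proof -
  have "(a \<circ> skip m) ` {..<x} = a ` {..<x}" if "x < m" for x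
    using that by (intro image_cong) (auto simp: skip_def)
  then show ?thesis unfolding restricted_growth_def by (simp add: skip_def)
qed

text \<open>By \<open>2 * m \<le> n\<close>, position \<open>m\<close> lies after the first
  \<open>m\<close> and before the last \<open>m\<close> of the \<open>Suc n\<close> positions.
  Deletion therefore keeps the start and merely shifts the end by one.\<close>

lemma delete_at_normal_iff:
  assumes "2 * m \<le> n"
  shows "(a, e) \<in> normal_sequences k m (Suc n) \<longleftrightarrow>
    delete_at m (a, e) \<in> normal_sequences k m n \<and> letter_at m (a, e) \<in> letters k"
proof -
  have all: "(\<forall>i<Suc n. P i) \<longleftrightarrow> P m \<and> (\<forall>i<n. P (skip m i))" for P
    using assms skip_unskip[of _ m] skip_less_Suc[of m n]
    by (metis le_add1 le_trans less_Suc_eq_le mult_2)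
  have ext: "f \<in> extensional {..<Suc n} \<longleftrightarrow> f \<circ> skip m \<in> extensional {..<n}"
    for f :: "nat \<Rightarrow> 'b"
  proof -
    have "(\<forall>i\<ge>Suc n. f i = undefined) \<longleftrightarrow> (\<forall>i\<ge>n. f (Suc i) = undefined)"
      by (metis Suc_le_D Suc_le_mono)
    then show ?thesis using assms
      by (simp add: extensional_def not_less skip_def)
  qed
  have rb: "(a, e) \<in> rainbow_sequences k (Suc n) \<longleftrightarrow>
      delete_at m (a, e) \<in> rainbow_sequences k n \<and> letter_at m (a, e) \<in> letters k"
    unfolding delete_at_def letter_at_def prod.case mem_rainbow_sequences ext all by auto
  have pre: "(\<exists>x<m. (a \<circ> skip m) x = c) \<longleftrightarrow> (\<exists>x<m. a x = c)" for c
    by (auto simp: skip_def)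
  have suf: "(\<exists>y\<in>{Suc n - m..<Suc n}. e y = {c}) \<longleftrightarrow> (\<exists>y\<in>{n - m..<n}. (e \<circ> skip m) y = {c})" for c
  proof -
    have late: "{Suc n - m..<Suc n} = Suc ` {n - m..<n}"
      using assms by (simp add: Suc_diff_le)
    have "skip m y = Suc y" if "y \<in> {n - m..<n}" for y
      using that assms by (auto simp: skip_def)
    then show ?thesis unfolding late bex_simps(7) comp_apply by (intro bex_cong) auto
  qed
  show ?thesis
    using rb suf pre by (auto simp: mem_normal_sequences delete_at_def simp del: comp_apply)
qed

text \<open>Any letter can be inserted at \<open>m\<close> into any normal sequence; this gives
  surjectivity onto the product.\<close>

lemma image_delete_letter_normal:
  assumes "2 * m \<le> n"
  shows "(\<lambda>S. (delete_at m S, letter_at m S)) ` normal_sequences k m (Suc n) =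
    normal_sequences k m n \<times> letters k" (is "?h ` _ = _")
proof (intro equalityI subsetI)
  fix p assume "p \<in> ?h ` normal_sequences k m (Suc n)"
  then obtain a e where "(a, e) \<in> normal_sequences k m (Suc n)" "p = ?h (a, e)" by auto
  then show "p \<in> normal_sequences k m n \<times> letters k"
    unfolding delete_at_normal_iff[OF assms] by simp
next
  fix p assume p: "p \<in> normal_sequences k m n \<times> letters k"
  obtain a e c s where p_eq: "p = ((a, e), (c, s))"
    by (cases p; cases "fst p"; cases "snd p") auto
  define a' where "a' i = (if i = m then c else a (unskip m i))" for i
  define e' where "e' i = (if i = m then s else e (unskip m i))" for i
  have h: "?h (a', e') = p"
    by (auto simp: p_eq delete_at_def letter_at_def a'_def e'_def fun_eq_iff)
  then have "(a', e') \<in> normal_sequences k m (Suc n)"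
    using p unfolding delete_at_normal_iff[OF assms] by (metis mem_Sigma_iff)
  then show "p \<in> ?h ` normal_sequences k m (Suc n)"
    unfolding h[symmetric] by (rule imageI)
qed

text \<open>From left to right, the letter at \<open>m\<close> can be read off the graph.
  Conversely, the edges at \<open>m\<close> depend on that letter, on \<open>a\<close> before
  \<open>m\<close> and on \<open>e\<close> after \<open>m\<close>. The shorter graph determines the
  latter two.\<close>

lemma graph_of_delete_iff:
  assumes mn: "2 * m \<le> n"
    and S: "S \<in> normal_sequences k m (Suc n)" and T: "T \<in> normal_sequences k m (Suc n)"
  shows "graph_of (Suc n) S = graph_of (Suc n) T \<longleftrightarrow>
    graph_of n (delete_at m S) = graph_of n (delete_at m T) \<and> letter_at m S = letter_at m T"
proof -
  obtain a e a' e' where ST: "S = (a, e)" "T = (a', e')" by (cases S, cases T)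
  have "m \<le> n" using mn by simp
  show ?thesis
  proof
    assume eq: "graph_of (Suc n) S = graph_of (Suc n) T"
    have "a m = a' m" "e m = e' m"
      using normal_sequences_graph_eqD[OF S[unfolded ST] T[unfolded ST] eq[unfolded ST]] mn
      by auto
    moreover have "graph_of n (delete_at m S) = graph_of n (delete_at m T)"
      using eq skip_less_Suc[OF \<open>m \<le> n\<close>] unfolding ST delete_at_def prod.case graph_of_eq_iff
      by simp
    ultimately show "graph_of n (delete_at m S) = graph_of n (delete_at m T) \<and>
      letter_at m S = letter_at m T" by (simp add: ST letter_at_def)
  next
    assume R: "graph_of n (delete_at m S) = graph_of n (delete_at m T) \<and>
      letter_at m S = letter_at m T"
    then have m_eq: "a m = a' m" "e m = e' m" by (auto simp: ST letter_at_def)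
    have del: "(a \<circ> skip m, e \<circ> skip m) \<in> normal_sequences k m n"
      "(a' \<circ> skip m, e' \<circ> skip m) \<in> normal_sequences k m n"
      using S T delete_at_normal_iff[OF mn] by (auto simp: ST delete_at_def)
    have eq: "graph_of n (a \<circ> skip m, e \<circ> skip m) = graph_of n (a' \<circ> skip m, e' \<circ> skip m)"
      using R by (simp add: ST delete_at_def)
    note D = normal_sequences_graph_eqD[OF del eq mn]
    have "a x \<in> e y \<longleftrightarrow> a' x \<in> e' y" if xy: "x < y" "y < Suc n" for x y
    proof -
      consider "x = m" | "y = m" | "x \<noteq> m" "y \<noteq> m" by blast
      then show ?thesis
      proof cases
        case 1
        then have "e y = e' y" using D(2)[of "y - 1"] xy by (auto simp: skip_def)
        then show ?thesis using 1 m_eq by simp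
      next
        case 2
        then have "a x = a' x" using D(1)[of x] xy mn by (auto simp: skip_def)
        then show ?thesis using 2 m_eq by simp
      next
        case 3
        then obtain i j where ij: "x = skip m i" "y = skip m j" by (metis skip_unskip)
        then have "i < j" "j < n" using xy skip_less_Suc[OF \<open>m \<le> n\<close>] by auto
        then show ?thesis using graph_of_eqD[OF eq, of i j] by (simp add: ij)
      qed
    qed
    then show "graph_of (Suc n) S = graph_of (Suc n) T"
      unfolding ST graph_of_eq_iff by blast
  qed
qed

section \<open>Isolated vertices under deletion\<close>

text \<open>A vertex before the last \<open>m\<close> is joined to a late vertex whose
  \<open>e\<close> is the singleton of its colour. A late vertex has all colours before it, so it
  has no earlier neighbour only if its \<open>e\<close> is empty.\<close>

lemma isolated_normal:
  assumes S: "(a, e) \<in> normal_sequences k m n" and mn: "2 * m \<le> n" and v: "v < n"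
  shows "(\<forall>w<n. \<not> adjacent (graph_of n (a, e)) v w) \<longleftrightarrow>
    n - m \<le> v \<and> e v = {} \<and> (\<forall>w. v < w \<and> w < n \<longrightarrow> a v \<notin> e w)"
proof
  assume iso: "\<forall>w<n. \<not> adjacent (graph_of n (a, e)) v w"
  have up: "\<forall>w. v < w \<and> w < n \<longrightarrow> a v \<notin> e w"
    using iso by (auto simp: adjacent_graph_of_iff)
  have late: "n - m \<le> v"
  proof (rule ccontr)
    assume *: "\<not> n - m \<le> v"
    have "a v < k" using S v by (simp add: mem_normal_sequences mem_rainbow_sequences)
    then obtain y where "y \<in> {n - m..<n}" "e y = {a v}"
      using S unfolding mem_normal_sequences by blast
    then have "v < y" "y < n" using * by auto
    then have "a v \<notin> e y" using up by blast
    then show False using \<open>e y = {a v}\<close> by simp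
  qed
  have "c \<notin> e v" for c
  proof
    assume c: "c \<in> e v"
    then have "c < k" using S v by (auto simp: mem_normal_sequences mem_rainbow_sequences)
    then obtain x where x: "x < m" "a x = c" using S unfolding mem_normal_sequences by blast
    then have "x < v" using late mn by simp
    then show False using iso c x v by (auto simp: adjacent_graph_of_iff)
  qed
  then show "n - m \<le> v \<and> e v = {} \<and> (\<forall>w. v < w \<and> w < n \<longrightarrow> a v \<notin> e w)"
    using late up by blast
qed (auto simp: adjacent_graph_of_iff)

lemma has_isolated_normal:
  assumes "(a, e) \<in> normal_sequences k m n" and "2 * m \<le> n"
  shows "has_isolated (graph_of n (a, e)) \<longleftrightarrow>
    (\<exists>v<n. n - m \<le> v \<and> e v = {} \<and> (\<forall>w. v < w \<and> w < n \<longrightarrow> a v \<notin> e w))"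
  unfolding has_isolated_def verts_graph_of Bex_def Ball_def lessThan_iff
  by (intro ex_cong1 conj_cong refl isolated_normal[OF assms])

text \<open>The criterion of \<open>has_isolated_normal\<close> inspects only the last
  \<open>m\<close> positions, and deletion just shifts these by one.\<close>

lemma has_isolated_delete:
  assumes mn: "2 * m \<le> n" and S: "S \<in> normal_sequences k m (Suc n)"
  shows "has_isolated (graph_of (Suc n) S) \<longleftrightarrow> has_isolated (graph_of n (delete_at m S))"
proof -
  obtain a e where S_eq: "S = (a, e)" by (cases S)
  have del: "(a \<circ> skip m, e \<circ> skip m) \<in> normal_sequences k m n"
    using S delete_at_normal_iff[OF mn] by (auto simp: S_eq delete_at_def)
  define I where "I v \<longleftrightarrow> Suc n - m \<le> v \<and> e v = {} \<and>
    (\<forall>w. v < w \<and> w < Suc n \<longrightarrow> a v \<notin> e w)" for v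
  define J where "J v \<longleftrightarrow> n - m \<le> v \<and> (e \<circ> skip m) v = {} \<and>
    (\<forall>w. v < w \<and> w < n \<longrightarrow> (a \<circ> skip m) v \<notin> (e \<circ> skip m) w)" for v
  have shift: "I (Suc v) \<longleftrightarrow> J v" for v
  proof (cases "n - m \<le> v")
    case True
    then have sk: "skip m w = Suc w" if "v \<le> w" for w
      using that mn by (simp add: skip_def)
    have "(\<forall>w. Suc v < w \<and> w < Suc n \<longrightarrow> a (Suc v) \<notin> e w) \<longleftrightarrow>
      (\<forall>w. v < w \<and> w < n \<longrightarrow> (a \<circ> skip m) v \<notin> (e \<circ> skip m) w)" (is "?A \<longleftrightarrow> ?B")
    proof
      assume A: ?A
      show ?B
      proof (intro allI impI)
        fix w assume "v < w \<and> w < n"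
        then show "(a \<circ> skip m) v \<notin> (e \<circ> skip m) w"
          using A[rule_format, of "Suc w"] by (simp add: sk)
      qed
    next
      assume B: ?B
      show ?A
      proof (intro allI impI)
        fix w assume w: "Suc v < w \<and> w < Suc n"
        then obtain u where "w = Suc u" by (cases w) auto
        then show "a (Suc v) \<notin> e w"
          using B[rule_format, of u] w by (simp add: sk)
      qed
    qed
    moreover have "Suc n - m \<le> Suc v" using True by simp
    ultimately show ?thesis
      unfolding I_def J_def using True by (simp add: sk del: all_simps)
  next
    case False
    moreover from this have "\<not> Suc n - m \<le> Suc v" using mn by simp
    ultimately show ?thesis unfolding I_def J_def by blast
  qed
  \<comment> \<open>Position \<open>0\<close> is not late, so the search over
    \<open>v < Suc n\<close> reduces to successors.\<close>
  have "\<not> I 0" using mn by (simp add: I_def)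
  have "has_isolated (graph_of (Suc n) S) \<longleftrightarrow> (\<exists>v<Suc n. I v)"
    unfolding S_eq I_def by (rule has_isolated_normal[OF S[unfolded S_eq]]) (use mn in simp)
  also have "\<dots> \<longleftrightarrow> (\<exists>v<n. J v)"
    using \<open>\<not> I 0\<close> by (simp only: Ex_less_Suc2 shift simp_thms)
  also have "\<dots> \<longleftrightarrow> has_isolated (graph_of n (delete_at m S))"
    unfolding S_eq delete_at_def prod.case J_def
    by (rule has_isolated_normal[OF del mn, symmetric])
  finally show ?thesis .
qed

section \<open>Counting normal graphs\<close>

text \<open>Both images index the classes of the same equivalence relation on
  \<open>A\<close>.\<close>

lemma card_image_eq_if_kernel:
  assumes "\<And>x y. x \<in> A \<Longrightarrow> y \<in> A \<Longrightarrow> f x = f y \<longleftrightarrow> g x = g y"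
  shows "card (f ` A) = card (g ` A)"
proof -
  have "bij_betw (\<lambda>z. g (inv_into A f z)) (f ` A) (g ` A)"
    unfolding bij_betw_def
  proof
    show "inj_on (\<lambda>z. g (inv_into A f z)) (f ` A)"
      by (intro inj_onI) (metis assms f_inv_into_f inv_into_into)
    have "g (inv_into A f (f x)) = g x" if "x \<in> A" for x
      using that assms by (metis f_inv_into_f imageI inv_into_into)
    then show "(\<lambda>z. g (inv_into A f z)) ` f ` A = g ` A"
      by (simp add: image_image)
  qed
  then show ?thesis by (rule bij_betw_same_card)
qed

definition normal_graphs :: "nat \<Rightarrow> nat \<Rightarrow> nat \<Rightarrow> nat graph set" where
  "normal_graphs k m n = graph_of n ` normal_sequences k m n"

text \<open>An abstract condition, so that one count serves both \<open>has_isolated\<close> and the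
  property that always holds.\<close>

definition deletion_invariant :: "nat \<Rightarrow> nat \<Rightarrow> (nat graph \<Rightarrow> bool) \<Rightarrow> bool" where
  "deletion_invariant k m P \<longleftrightarrow> (\<forall>n\<ge>2 * m. \<forall>S \<in> normal_sequences k m (Suc n).
     P (graph_of (Suc n) S) \<longleftrightarrow> P (graph_of n (delete_at m S)))"

lemma card_letters: "card (letters k) = k * 2 ^ k"
  by (simp add: card_cartesian_product card_Pow)

text \<open>On normal sequences, the graph has the same kernel as the pair of the graph after
  deletion and the deleted letter. These pairs run through a full product.\<close>

lemma card_normal_graphs_Suc:
  assumes mn: "2 * m \<le> n" and inv: "deletion_invariant k m P"
  shows "card {G \<in> normal_graphs k m (Suc n). P G} =
    (k * 2 ^ k) * card {G \<in> normal_graphs k m n. P G}"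
proof -
  define A where "A = {S \<in> normal_sequences k m (Suc n). P (graph_of (Suc n) S)}"
  define B where "B = {S \<in> normal_sequences k m n. P (graph_of n S)}"
  define h where "h S = (delete_at m S, letter_at m S)" for S
  define g where "g = map_prod (graph_of n) (id :: nat \<times> nat set \<Rightarrow> _)"
  have "h ` A = {p \<in> h ` normal_sequences k m (Suc n). P (graph_of n (fst p))}"
    unfolding A_def h_def using inv mn by (auto simp: deletion_invariant_def)
  also have "h ` normal_sequences k m (Suc n) = normal_sequences k m n \<times> letters k"
    unfolding h_def by (rule image_delete_letter_normal[OF mn])
  also have "{p \<in> normal_sequences k m n \<times> letters k. P (graph_of n (fst p))} = B \<times> letters k"
    by (auto simp: B_def)
  finally have hA: "h ` A = B \<times> letters k" .
  have "card (graph_of (Suc n) ` A) = card ((g \<circ> h) ` A)"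
    by (rule card_image_eq_if_kernel)
      (use graph_of_delete_iff[OF mn] in \<open>auto simp: A_def g_def h_def\<close>)
  also have "(g \<circ> h) ` A = graph_of n ` B \<times> letters k"
    unfolding image_comp[symmetric] hA g_def by (auto simp: image_iff)
  also have "card (graph_of n ` B \<times> letters k) = card (graph_of n ` B) * card (letters k)"
    by (rule card_cartesian_product)
  finally have "card (graph_of (Suc n) ` A) = (k * 2 ^ k) * card (graph_of n ` B)"
    unfolding card_letters by simp
  moreover have "{G \<in> normal_graphs k m (Suc n). P G} = graph_of (Suc n) ` A"
    "{G \<in> normal_graphs k m n. P G} = graph_of n ` B"
    by (auto simp: normal_graphs_def A_def B_def)
  ultimately show ?thesis by simp
qed

lemma card_normal_graphs:
  assumes "2 * m \<le> n" and "deletion_invariant k m P"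
  shows "card {G \<in> normal_graphs k m n. P G} =
    (k * 2 ^ k) ^ (n - 2 * m) * card {G \<in> normal_graphs k m (2 * m). P G}"
  using assms(1)
proof (induction n rule: dec_induct)
  case (step n)
  then show ?case
    using card_normal_graphs_Suc[OF step.hyps(1) assms(2)] by (simp add: Suc_diff_le)
qed simp

section \<open>Bounding the sequences that are not well spread\<close>

lemma card_PiE_avoid:
  assumes "finite I" "finite B" "J \<subseteq> I" "b \<in> B"
  shows "card {f \<in> I \<rightarrow>\<^sub>E B. b \<notin> f ` J} = (card B - 1) ^ card J * card B ^ (card I - card J)"
proof -
  have "{f \<in> I \<rightarrow>\<^sub>E B. b \<notin> f ` J} = (\<Pi>\<^sub>E i\<in>I. if i \<in> J then B - {b} else B)"
    using assms(3) by (fastforce simp: PiE_iff split: if_splits)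
  also have "card \<dots> = (\<Prod>i\<in>I. if i \<in> J then card B - 1 else card B)"
    using assms by (subst card_PiE) (auto intro!: prod.cong)
  also have "\<dots> = (card B - 1) ^ card J * card B ^ card (I - J)"
    using assms by (simp add: prod.If_cases Int_absorb1 Diff_eq[symmetric])
  also have "card (I - J) = card I - card J"
    using assms by (simp add: card_Diff_subset finite_subset)
  finally show ?thesis .
qed

lemma card_rainbow_sequences: "card (rainbow_sequences k n) = (k * 2 ^ k) ^ n"
  by (simp add: rainbow_sequences_def card_cartesian_product card_PiE card_Pow power_mult_distrib)

lemma finite_rainbow_sequences: "finite (rainbow_sequences k n)"
  by (auto simp: rainbow_sequences_def intro!: finite_cartesian_product finite_PiE)

text \<open>A union bound for a uniformly random sequence: each colour is absent from the first
  \<open>m\<close> values of \<open>a\<close> with probability \<open>(1 - 1 / k) ^ m\<close>, each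
  singleton from the last \<open>m\<close> values of \<open>e\<close> with probability
  \<open>(1 - 1 / 2 ^ k) ^ m\<close>.\<close>

definition miss :: "nat \<Rightarrow> nat \<Rightarrow> real" where
  "miss k m = real k * (1 - 1 / real k) ^ m + real k * (1 - 1 / 2 ^ k) ^ m"

lemma miss_tendsto_0:
  assumes "k \<ge> 1" shows "miss k \<longlonglongrightarrow> 0"
proof -
  have "(\<lambda>m. real k * (1 - 1 / real k) ^ m + real k * (1 - 1 / 2 ^ k) ^ m)
    \<longlonglongrightarrow> real k * 0 + real k * 0"
    using assms by (intro tendsto_intros LIMSEQ_power_zero) auto
  then show ?thesis by (simp add: miss_def[abs_def])
qed

lemma card_not_well_spread:
  assumes "k \<ge> 1" "m \<le> n"
  shows "real (card (rainbow_sequences k n - well_spread_sequences k m n)) \<le>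
    miss k m * real (k * 2 ^ k) ^ n"
proof -
  let ?A = "{..<n} \<rightarrow>\<^sub>E {..<k}" and ?E = "{..<n} \<rightarrow>\<^sub>E Pow {..<k}"
  define X where "X c = {a \<in> ?A. c \<notin> a ` {..<m}}" for c
  define Y where "Y c = {e \<in> ?E. {c} \<notin> e ` {n - m..<n}}" for c
  have fin: "finite ?A" "finite ?E" by (auto intro!: finite_PiE)
  have cA: "card ?A = k ^ n" and cE: "card ?E = (2 ^ k) ^ n"
    by (simp_all add: card_PiE card_Pow)
  \<comment> \<open>This turns the exact counts of avoiding functions into proportions of all
    functions.\<close>
  have pow: "(q - 1) ^ m * q ^ (n - m) = (1 - 1 / q) ^ m * q ^ n" if "q > 0" for q :: real
  proof -
    have "(q - 1) ^ m = ((1 - 1 / q) * q) ^ m" using that by (simp add: algebra_simps)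
    then show ?thesis using \<open>m \<le> n\<close>
      by (simp add: power_mult_distrib power_add[symmetric])
  qed
  have cX: "real (card (X c)) = (1 - 1 / real k) ^ m * real k ^ n" if "c < k" for c
  proof -
    have "card (X c) = (k - 1) ^ m * k ^ (n - m)"
      unfolding X_def using that \<open>m \<le> n\<close> by (subst card_PiE_avoid) auto
    then show ?thesis using pow[of "real k"] \<open>k \<ge> 1\<close> by (simp add: of_nat_diff)
  qed
  have cY: "real (card (Y c)) = (1 - 1 / 2 ^ k) ^ m * (2 ^ k) ^ n" if "c < k" for c
  proof -
    have "card (Y c) = (2 ^ k - 1) ^ m * (2 ^ k) ^ (n - m)"
      unfolding Y_def using that \<open>m \<le> n\<close> by (subst card_PiE_avoid) (auto simp: card_Pow)
    then show ?thesis using pow[of "2 ^ k"] by (simp add: of_nat_diff)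
  qed
  have "rainbow_sequences k n - well_spread_sequences k m n \<subseteq>
      (\<Union>c<k. X c \<times> ?E) \<union> (\<Union>c<k. ?A \<times> Y c)" (is "_ \<subseteq> ?U \<union> ?V")
    by (auto simp: rainbow_sequences_def well_spread_sequences_def X_def Y_def)
  moreover have "finite (?U \<union> ?V)"
    using fin by (auto simp: X_def Y_def)
  ultimately have "card (rainbow_sequences k n - well_spread_sequences k m n) \<le> card (?U \<union> ?V)"
    by (intro card_mono)
  also have "\<dots> \<le> card ?U + card ?V" by (rule card_Un_le)
  also have "\<dots> \<le> (\<Sum>c<k. card (X c \<times> ?E)) + (\<Sum>c<k. card (?A \<times> Y c))"
    by (intro add_mono card_UN_le) auto
  finally have "real (card (rainbow_sequences k n - well_spread_sequences k m n)) \<le>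
    real ((\<Sum>c<k. card (X c \<times> ?E)) + (\<Sum>c<k. card (?A \<times> Y c)))"
    by (simp only: of_nat_le_iff)
  also have "\<dots> = (\<Sum>c<k. (1 - 1 / real k) ^ m * real k ^ n * (2 ^ k) ^ n) +
      (\<Sum>c<k. real k ^ n * ((1 - 1 / 2 ^ k) ^ m * (2 ^ k) ^ n))"
    by (simp add: card_cartesian_product cA cE cX cY)
  also have "\<dots> = miss k m * real (k * 2 ^ k) ^ n"
    by (simp add: miss_def algebra_simps power_mult_distrib)
  finally show ?thesis .
qed

section \<open>Convergence of the densities\<close>

lemma normal_graphs_subset: "normal_graphs k m n \<subseteq> \<bbbG> k n"
  unfolding normal_graphs_def rainbow_threshold_graphs_def normal_sequences_def
    well_spread_sequences_def by auto

text \<open>The normal graphs with \<open>P\<close> have density exactly \<open>d\<close>, for every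
  \<open>n \<ge> 2 * m\<close>. All other graphs come from sequences that are not well spread, and
  \<open>miss k m\<close> bounds their share independently of \<open>n\<close>.\<close>

lemma density_bounds:
  assumes k: "k \<ge> 1" and mn: "2 * m \<le> n" and inv: "deletion_invariant k m P"
  defines "d \<equiv> real (card {G \<in> normal_graphs k m (2 * m). P G}) / real (k * 2 ^ k) ^ (2 * m)"
  shows "d \<le> real (card {G \<in> \<bbbG> k n. P G}) / real (k * 2 ^ k) ^ n"
    and "real (card {G \<in> \<bbbG> k n. P G}) / real (k * 2 ^ k) ^ n \<le> d + miss k m"
proof -
  let ?K = "real (k * 2 ^ k)"
  let ?M = "{G \<in> normal_graphs k m n. P G}" and ?N = "{G \<in> \<bbbG> k n. P G}"
  let ?R = "rainbow_sequences k n - well_spread_sequences k m n"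
  have K: "?K > 0" using k by simp
  have "real (card ?M) = ?K ^ (n - 2 * m) * real (card {G \<in> normal_graphs k m (2 * m). P G})"
    unfolding card_normal_graphs[OF mn inv] of_nat_mult of_nat_power ..
  also have "?K ^ (n - 2 * m) = ?K ^ n / ?K ^ (2 * m)"
    using mn by (intro power_diff less_imp_neq[OF K, symmetric])
  finally have M: "real (card ?M) = d * ?K ^ n"
    unfolding d_def times_divide_eq_left times_divide_eq_right by (simp only: mult.commute)
  have fin: "finite ?N" using finite_rainbow_threshold_graphs by simp
  have "card ?M \<le> card ?N"
    using normal_graphs_subset fin by (intro card_mono) auto
  then have "d * ?K ^ n \<le> real (card ?N)"
    unfolding M[symmetric] by (rule of_nat_mono)
  then show "d \<le> real (card ?N) / ?K ^ n"
    unfolding pos_le_divide_eq[OF zero_less_power[OF K]] .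
  have "?N \<subseteq> ?M \<union> graph_of n ` ?R"
  proof
    fix G assume G: "G \<in> ?N"
    then obtain S where S: "S \<in> rainbow_sequences k n" "G = graph_of n S"
      unfolding rainbow_threshold_graphs_def by blast
    show "G \<in> ?M \<union> graph_of n ` ?R"
    proof (cases "S \<in> well_spread_sequences k m n")
      case True
      then have "G \<in> graph_of n ` well_spread_sequences k m n" using S(2) by (rule rev_image_eqI)
      then have "G \<in> normal_graphs k m n"
        unfolding normal_graphs_def
        by (rule subsetD[OF graph_of_well_spread_subset_normal, rotated]) (use mn in simp)
      then show ?thesis using G by simp
    next
      case False
      then have "S \<in> ?R" using S(1) by simp
      then have "G \<in> graph_of n ` ?R" using S(2) by (rule rev_image_eqI)
      then show ?thesis by (rule UnI2)
    qed
  qed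
  moreover have "finite (graph_of n ` ?R)"
    by (intro finite_imageI finite_Diff finite_rainbow_sequences)
  moreover have "finite ?M"
    using fin by (rule finite_subset[rotated]) (use normal_graphs_subset in auto)
  ultimately have "card ?N \<le> card (?M \<union> graph_of n ` ?R)" by (intro card_mono finite_UnI)
  also have "\<dots> \<le> card ?M + card (graph_of n ` ?R)" by (rule card_Un_le)
  finally have "card ?N \<le> card ?M + card (graph_of n ` ?R)" .
  moreover have "card (graph_of n ` ?R) \<le> card ?R"
    by (intro card_image_le finite_Diff finite_rainbow_sequences)
  ultimately have "real (card ?N) \<le> real (card ?M) + real (card ?R)" by linarith
  also have "\<dots> \<le> d * ?K ^ n + miss k m * ?K ^ n"
    unfolding M by (intro add_left_mono card_not_well_spread[OF k]) (use mn in simp)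
  finally have "real (card ?N) \<le> (d + miss k m) * ?K ^ n"
    by (simp only: distrib_right)
  then show "real (card ?N) / ?K ^ n \<le> d + miss k m"
    unfolding pos_divide_le_eq[OF zero_less_power[OF K]] .
qed

text \<open>From \<open>2 * m\<close> on, all densities lie in one interval of length
  \<open>miss k m\<close>, which is arbitrarily small for suitable \<open>m\<close>.\<close>

lemma convergent_density:
  assumes k: "k \<ge> 1" and inv: "\<And>m. deletion_invariant k m P"
  shows "convergent (\<lambda>n. real (card {G \<in> \<bbbG> k n. P G}) / real (k * 2 ^ k) ^ n)"
    (is "convergent ?r")
proof -
  have "Cauchy ?r"
  proof (rule metric_CauchyI)
    fix \<epsilon> :: real assume "\<epsilon> > 0"
    then obtain m where m: "miss k m < \<epsilon>"
      using order_tendstoD(2)[OF miss_tendsto_0[OF k]] by (auto simp: eventually_sequentially)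
    show "\<exists>M. \<forall>i\<ge>M. \<forall>j\<ge>M. dist (?r i) (?r j) < \<epsilon>"
    proof (intro exI[of _ "2 * m"] allI impI)
      fix i j assume "2 * m \<le> i" "2 * m \<le> j"
      then show "dist (?r i) (?r j) < \<epsilon>"
        using density_bounds[OF k _ inv, of m i] density_bounds[OF k _ inv, of m j] m
        unfolding dist_real_def by linarith
    qed
  qed
  then show ?thesis by (rule Cauchy_convergent)
qed

text \<open>Once \<open>miss k m < 1\<close>, some sequence of length \<open>2 * m\<close> is well
  spread. So there is a normal graph, and the density of normal graphs is a positive
  constant.\<close>

lemma total_density_bounded_below:
  assumes k: "k \<ge> 1"
  obtains \<delta> N where "\<delta> > 0"
    "\<And>n. n \<ge> N \<Longrightarrow> \<delta> \<le> real (card (\<bbbG> k n)) / real (k * 2 ^ k) ^ n"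
proof -
  obtain m where m: "miss k m < 1"
    using order_tendstoD(2)[OF miss_tendsto_0[OF k], of 1] by (auto simp: eventually_sequentially)
  let ?W = "well_spread_sequences k m (2 * m)"
  have "?W \<noteq> {}"
  proof
    assume "?W = {}"
    then have "real (k * 2 ^ k) ^ (2 * m) \<le> miss k m * real (k * 2 ^ k) ^ (2 * m)"
      using card_not_well_spread[OF k, of m "2 * m"] by (simp add: card_rainbow_sequences)
    moreover have "real (k * 2 ^ k) ^ (2 * m) > 0" using k by simp
    ultimately show False using m by simp
  qed
  then have "normal_graphs k m (2 * m) \<noteq> {}"
    using graph_of_well_spread_subset_normal[of m "2 * m" k] by (auto simp: normal_graphs_def)
  moreover have "finite (normal_graphs k m (2 * m))"
    using finite_rainbow_threshold_graphs normal_graphs_subset by (rule finite_subset[rotated])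
  ultimately have pos: "card (normal_graphs k m (2 * m)) > 0" by (simp add: card_gt_0_iff)
  show thesis
  proof (rule that)
    show "real (card (normal_graphs k m (2 * m))) / real (k * 2 ^ k) ^ (2 * m) > 0"
      using pos k by simp
    fix n assume "2 * m \<le> n"
    then show "real (card (normal_graphs k m (2 * m))) / real (k * 2 ^ k) ^ (2 * m) \<le>
      real (card (\<bbbG> k n)) / real (k * 2 ^ k) ^ n"
      using density_bounds(1)[OF k, of m n "\<lambda>_. True"] by (simp add: deletion_invariant_def)
  qed
qed

section \<open>Appending a last vertex\<close>

text \<open>Restriction to \<open>[n]\<close> recovers the original graph from the extended one, so
  it maps the graphs with \<open>P\<close> onto a set containing \<open>\<bbbG> k n\<close>.\<close>

lemma card_append_vertex:
  assumes s: "s \<subseteq> {..<k}" and k: "k \<ge> 1"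
    and P: "\<And>a e. a ` {..<n} \<subseteq> {..<k} \<Longrightarrow> e n = s \<Longrightarrow> P (graph_of (Suc n) (a, e))"
  shows "card (\<bbbG> k n) \<le> card {G \<in> \<bbbG> k (Suc n). P G}"
proof -
  \<comment> \<open>The colour of the last vertex influences no edge; \<open>0\<close> is a legal
    choice since \<open>k \<ge> 1\<close>.\<close>
  define ext where "ext = (\<lambda>(a, e). (a(n := 0 :: nat), e(n := s)))"
  have ext: "ext S \<in> rainbow_sequences k (Suc n)" if "S \<in> rainbow_sequences k n" for S
    using that s k
    by (cases S) (auto simp: ext_def mem_rainbow_sequences extensional_def less_Suc_eq)
  have PS: "P (graph_of (Suc n) (ext S))" if "S \<in> rainbow_sequences k n" for S
    using that unfolding ext_def
    by (cases S) (auto simp: mem_rainbow_sequences intro!: P)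
  define rest where "rest G = ({..<n}, {A \<in> edges G. A \<subseteq> {..<n}})" for G :: "nat graph"
  have rest: "rest (graph_of (Suc n) (ext S)) = graph_of n S" for S
  proof (cases S)
    case (Pair a e)
    have "rest (graph_of (Suc n) (a', e')) = graph_of n (a', e')" for a' e'
      by (fastforce simp: rest_def graph_of_def)
    then show ?thesis by (simp add: Pair ext_def graph_of_eq_iff)
  qed
  show ?thesis
  proof (rule surj_card_le)
    show "finite {G \<in> \<bbbG> k (Suc n). P G}" using finite_rainbow_threshold_graphs by simp
    show "\<bbbG> k n \<subseteq> rest ` {G \<in> \<bbbG> k (Suc n). P G}"
    proof
      fix G assume "G \<in> \<bbbG> k n"
      then obtain S where S: "S \<in> rainbow_sequences k n" "G = graph_of n S"
        unfolding rainbow_threshold_graphs_def by blast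
      have "graph_of (Suc n) (ext S) \<in> {G \<in> \<bbbG> k (Suc n). P G}"
        unfolding rainbow_threshold_graphs_def using ext[OF S(1)] PS[OF S(1)] by simp
      then show "G \<in> rest ` {G \<in> \<bbbG> k (Suc n). P G}"
        by (rule rev_image_eqI) (simp add: rest S(2))
    qed
  qed
qed

lemma card_isolated_ge:
  assumes "k \<ge> 1"
  shows "card (\<bbbG> k n) \<le> card {G \<in> \<bbbG> k (Suc n). has_isolated G}"
  by (rule card_append_vertex[where s = "{}"])
    (use assms in \<open>auto simp: has_isolated_def adjacent_graph_of_iff intro!: bexI[of _ n]\<close>)

text \<open>The new vertex is joined to all others; \<open>n \<ge> 1\<close> guarantees that it has
  a neighbour itself.\<close>

lemma card_not_isolated_ge:
  assumes "k \<ge> 1" "n \<ge> 1"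
  shows "card (\<bbbG> k n) \<le> card {G \<in> \<bbbG> k (Suc n). \<not> has_isolated G}"
proof (rule card_append_vertex[where s = "{..<k}"])
  fix a :: "nat \<Rightarrow> nat" and e :: "nat \<Rightarrow> nat set"
  assume a: "a ` {..<n} \<subseteq> {..<k}" and e: "e n = {..<k}"
  have "\<exists>w<Suc n. adjacent (graph_of (Suc n) (a, e)) v w" if "v < Suc n" for v
  proof (cases "v = n")
    case True
    moreover have "a 0 < k" using a \<open>n \<ge> 1\<close> by (auto simp: image_subset_iff)
    ultimately show ?thesis using e \<open>n \<ge> 1\<close>
      by (intro exI[of _ 0]) (auto simp: adjacent_graph_of_iff)
  next
    case False
    then have "v < n" using that by simp
    moreover from this have "a v < k" using a by (auto simp: image_subset_iff)
    ultimately show ?thesis using e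
      by (intro exI[of _ n]) (auto simp: adjacent_graph_of_iff)
  qed
  then show "\<not> has_isolated (graph_of (Suc n) (a, e))" by (auto simp: has_isolated_def)
qed (use assms in auto)

section \<open>The limit of the proportions\<close>

theorem theorem4p1:
  shows "\<exists>\<phi>. sentence \<phi> \<and>
    (\<forall>k\<ge>1. \<exists>L::real.
       (\<lambda>n. real (card {G \<in> \<bbbG> k n. G \<Turnstile> \<phi>}) / real (card (\<bbbG> k n))) \<longlonglongrightarrow> L \<and>
       L \<notin> {0, 1})"
proof (intro exI[of _ isolated_formula] conjI allI impI)
  show "sentence isolated_formula" by (rule sentence_isolated)
  fix k :: nat assume k: "k \<ge> 1"
  let ?K = "real (k * 2 ^ k)"
  let ?A = "\<lambda>n. card {G \<in> \<bbbG> k n. has_isolated G}" and ?N = "\<lambda>n. card (\<bbbG> k n)"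
  have K: "?K > 0" using k by simp
  have "deletion_invariant k m has_isolated" for m
    using has_isolated_delete by (auto simp: deletion_invariant_def)
  then obtain A where A: "(\<lambda>n. real (?A n) / ?K ^ n) \<longlonglongrightarrow> A"
    using convergent_density[OF k, of has_isolated] by (auto simp: convergent_def)
  obtain N where N: "(\<lambda>n. real (?N n) / ?K ^ n) \<longlonglongrightarrow> N"
    using convergent_density[OF k, of "\<lambda>_. True"]
    by (auto simp: convergent_def deletion_invariant_def)
  obtain \<delta> n0 where \<delta>: "\<delta> > 0" "\<And>n. n \<ge> n0 \<Longrightarrow> \<delta> \<le> real (?N n) / ?K ^ n"
    using total_density_bounded_below[OF k] by blast
  have "\<delta> \<le> N" using \<delta>(2) by (intro LIMSEQ_le_const[OF N]) blast
  then have "N > 0" using \<delta>(1) by simp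
  \<comment> \<open>The appending bounds compare \<open>n\<close> with \<open>Suc n\<close>, so the
    scaling by \<open>?K ^ n\<close> costs one further factor \<open>?K\<close>.\<close>
  have N': "(\<lambda>n. real (?N n) / ?K ^ n / ?K) \<longlonglongrightarrow> N / ?K"
    using N by (rule tendsto_divide[OF _ tendsto_const]) (use k in simp)
  have "N / ?K \<le> A"
  proof (rule LIMSEQ_le[OF N' LIMSEQ_Suc[OF A]], intro exI allI impI)
    fix n
    show "real (?N n) / ?K ^ n / ?K \<le> real (?A (Suc n)) / ?K ^ Suc n"
      unfolding divide_divide_eq_left power_Suc2
      using card_isolated_ge[OF k, of n] by (intro divide_right_mono) auto
  qed
  then have "A > 0" using \<open>N > 0\<close> K by (smt (verit) divide_pos_pos)
  \<comment> \<open>\<open>N - A\<close> is the limiting density of graphs without isolated vertex,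
    bounded below by appending a dominating vertex.\<close>
  have "N / ?K \<le> N - A"
  proof (rule LIMSEQ_le[OF N' LIMSEQ_Suc[OF tendsto_diff[OF N A]]], intro exI allI impI)
    fix n :: nat assume "1 \<le> n"
    have "\<bbbG> k (Suc n) = {G \<in> \<bbbG> k (Suc n). has_isolated G} \<union>
        {G \<in> \<bbbG> k (Suc n). \<not> has_isolated G}" by blast
    also have "card \<dots> = ?A (Suc n) + card {G \<in> \<bbbG> k (Suc n). \<not> has_isolated G}"
      using finite_rainbow_threshold_graphs by (intro card_Un_disjoint) auto
    finally have "?N (Suc n) = ?A (Suc n) + card {G \<in> \<bbbG> k (Suc n). \<not> has_isolated G}" .
    then have "real (?N n) \<le> real (?N (Suc n)) - real (?A (Suc n))"
      using card_not_isolated_ge[OF k \<open>1 \<le> n\<close>] by simp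
    then show "real (?N n) / ?K ^ n / ?K \<le>
        real (?N (Suc n)) / ?K ^ Suc n - real (?A (Suc n)) / ?K ^ Suc n"
      unfolding divide_divide_eq_left power_Suc2 diff_divide_distrib[symmetric]
      by (intro divide_right_mono) auto
  qed
  then have "A < N" using \<open>N > 0\<close> K by (smt (verit) divide_pos_pos)
  \<comment> \<open>The common scaling cancels in the quotient, so the proportions tend to
    \<open>A / N\<close>, strictly between 0 and 1.\<close>
  have cancel: "(real (?A n) / ?K ^ n) / (real (?N n) / ?K ^ n) = real (?A n) / real (?N n)" for n
    using k by simp
  have "(\<lambda>n. (real (?A n) / ?K ^ n) / (real (?N n) / ?K ^ n)) \<longlonglongrightarrow> A / N"
    using \<open>N > 0\<close> by (intro tendsto_divide[OF A N]) simp
  then have "(\<lambda>n. real (?A n) / real (?N n)) \<longlonglongrightarrow> A / N" unfolding cancel .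
  then show "\<exists>L::real.
       (\<lambda>n. real (card {G \<in> \<bbbG> k n. G \<Turnstile> isolated_formula}) / real (card (\<bbbG> k n))) \<longlonglongrightarrow> L \<and>
       L \<notin> {0, 1}"
    using \<open>A > 0\<close> \<open>A < N\<close> by (intro exI[of _ "A / N"]) (simp add: models_isolated)
qed

end
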